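(* Each of the modal logics $\mathrm{ML}_{\dot\vee,\Diamond}({=}(\cdot),\Diamond_e)$, $\mathrm{ML}_{\to,\Diamond}(\dot\vee_g,\Diamond_e)$ and $\mathrm{ML}_{\to,\Diamond}(\Diamond_e)$ is expressively complete for the class of all convex modal team properties invariant under bounded bisimulation.
   Context: Modal team semantics: a Kripke model $M=(W,R,V)$ with a team being a subset $t\subseteq W$; $R[w]=\{v: wRv\}$. The logics are the propositional logics $\mathrm{CONDEP}$ (connectives $p,\bot,\wedge,\dot\vee,\neg$ on classical formulas, dependence atoms, $\Diamond_e$), $\mathrm{CONINQ}$ (connectives $p,\bot,\wedge,\to,\dot\vee_g,\Diamond_e$) and $\mathrm{PL}_{\to}(\Diamond_e)$ (connectives $p,\bot,\wedge,\to,\Diamond_e$) extended with the flat modalities $\Diamond,\Box$, where $M,t\vDash\Diamond\phi$ iff for every $w\in t$ there is a nonempty $s\subseteq R[w]$ with $M,s\vDash\phi$, and $M,t\vDash\Box\phi$ iff for every $w\in t$, $M,R[w]\vDash\phi$. Other clauses are the team analogues of the propositional ones: $t\vDash p$ iff $t\subseteq V(p)$; $t\vDash\bot$ iff $t=\emptyset$; $t\vDash\phi\,\dot\vee\,\psi$ iff $t\subseteq s\cup u$ with $s\vDash\phi$, $u\vDash\psi$; $t\vDash\phi\to\psi$ iff every $s\subseteq t$ satisfying $\phi$ satisfies $\psi$; $t\vDash\Diamond_e\phi$ ("epistemic might") iff some nonempty $s\subseteq t$ satisfies $\phi$; $t\vDash\phi\,\dot\vee_g\,\psi$ iff some $s\supseteq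 t$ satisfies $\phi$ or $\psi$. Dependence atoms take classical modal formulas: $t\vDash{=}(\alpha_1,\dots,\alpha_n,\alpha)$ iff for all $v,w\in t$, if $v,w$ agree on the truth of each $\alpha_i$ then they agree on the truth of $\alpha$. A property is convex if whenever $s,t$ are in it and $s\subseteq u\subseteq t$ then $u$ is in it; bisimulation is the standard team-semantic notion of bounded bisimulation.
   Formalization: Letters come from a finite set; the two logics with dotted disjunctions can define properties not invariant under bisimulation, so for them invariance is claimed only over classes of models realising the same bounded bisimulation types (definability and convexity hold over all models). *)

theory Defs
  imports Main
begin

section \<open>Models and bounded bisimulation\<close>

record ('w, 'p) kripke =
  worlds :: "'w set"
  acc :: "('w \<times> 'w) set"
  val :: "'p \<Rightarrow> 'w set"

definition kripke_models :: "('w, 'p) kripke set" where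
  "kripke_models = {M. worlds M \<noteq> {} \<and> acc M \<subseteq> worlds M \<times> worlds M \<and> (\<forall>p. val M p \<subseteq> worlds M)}"

definition succs :: "('w, 'p) kripke \<Rightarrow> 'w \<Rightarrow> 'w set" where
  "succs M w = acc M `` {w}"

fun bisim :: "'p set \<Rightarrow> nat \<Rightarrow> ('w, 'p) kripke \<Rightarrow> 'w \<Rightarrow> ('v, 'p) kripke \<Rightarrow> 'v \<Rightarrow> bool" where
  "bisim X 0 M w M' w' \<longleftrightarrow> (\<forall>p\<in>X. w \<in> val M p \<longleftrightarrow> w' \<in> val M' p)"
| "bisim X (Suc k) M w M' w' \<longleftrightarrow>
     (\<forall>p\<in>X. w \<in> val M p \<longleftrightarrow> w' \<in> val M' p)
     \<and> (\<forall>v\<in>succs M w. \<exists>v'\<in>succs M' w'. bisim X k M v M' v')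
     \<and> (\<forall>v'\<in>succs M' w'. \<exists>v\<in>succs M w. bisim X k M v M' v')"

definition team_bisim ::
  "'p set \<Rightarrow> nat \<Rightarrow> ('w, 'p) kripke \<Rightarrow> 'w set \<Rightarrow> ('v, 'p) kripke \<Rightarrow> 'v set \<Rightarrow> bool" where
  "team_bisim X k M t M' t' \<longleftrightarrow>
     (\<forall>w\<in>t. \<exists>w'\<in>t'. bisim X k M w M' w') \<and> (\<forall>w'\<in>t'. \<exists>w\<in>t. bisim X k M w M' w')"


section \<open>Formulas and team semantics\<close>

text \<open>All connectives live in one datatype with one satisfaction relation; the three logics are the
  fragments defined below. \<open>Disj\<close> is the dotted split disjunction, \<open>GDisj\<close> the dotted global
  disjunction, \<open>Might\<close> the epistemic might modality, and \<open>Dep [a\<^sub>1, \<dots>, a\<^sub>n] a\<close> the dependence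
  atom (a constancy atom when the list is empty).\<close>

datatype 'p fm =
    Var 'p
  | Bot
  | Neg "'p fm"
  | Dep "'p fm list" "'p fm"
  | And "'p fm" "'p fm"
  | Disj "'p fm" "'p fm"
  | GDisj "'p fm" "'p fm"
  | Imp "'p fm" "'p fm"
  | Might "'p fm"
  | Dia "'p fm"
  | Box "'p fm"

text \<open>\<open>Neg\<close> and the arguments of \<open>Dep\<close> only occur on classical formulas, whose truth at a world
  is their satisfaction by the singleton team. The teams quantified in \<open>Disj\<close> and \<open>GDisj\<close> range
  over the whole model, not just over subteams of \<open>t\<close>.\<close>

fun sat :: "('w, 'p) kripke \<Rightarrow> 'w set \<Rightarrow> 'p fm \<Rightarrow> bool" where
  "sat M t (Var p) \<longleftrightarrow> t \<subseteq> val M p"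
| "sat M t Bot \<longleftrightarrow> t = {}"
| "sat M t (Neg a) \<longleftrightarrow> (\<forall>w\<in>t. \<not> sat M {w} a)"
| "sat M t (Dep as a) \<longleftrightarrow>
     (\<forall>v\<in>t. \<forall>w\<in>t. (\<forall>b\<in>set as. sat M {v} b \<longleftrightarrow> sat M {w} b) \<longrightarrow> (sat M {v} a \<longleftrightarrow> sat M {w} a))"
| "sat M t (And f g) \<longleftrightarrow> sat M t f \<and> sat M t g"
| "sat M t (Disj f g) \<longleftrightarrow>
     (\<exists>s u. s \<subseteq> worlds M \<and> u \<subseteq> worlds M \<and> t \<subseteq> s \<union> u \<and> sat M s f \<and> sat M u g)"
| "sat M t (GDisj f g) \<longleftrightarrow> (\<exists>s. t \<subseteq> s \<and> s \<subseteq> worlds M \<and> (sat M s f \<or> sat M s g))"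
| "sat M t (Imp f g) \<longleftrightarrow> (\<forall>s. s \<subseteq> t \<longrightarrow> sat M s f \<longrightarrow> sat M s g)"
| "sat M t (Might f) \<longleftrightarrow> (\<exists>s. s \<noteq> {} \<and> s \<subseteq> t \<and> sat M s f)"
| "sat M t (Dia f) \<longleftrightarrow> (\<forall>w\<in>t. \<exists>s. s \<noteq> {} \<and> s \<subseteq> succs M w \<and> sat M s f)"
| "sat M t (Box f) \<longleftrightarrow> (\<forall>w\<in>t. sat M (succs M w) f)"

inductive_set classical_ML :: "'p set \<Rightarrow> 'p fm set" for X :: "'p set" where
  "p \<in> X \<Longrightarrow> Var p \<in> classical_ML X"
| "Bot \<in> classical_ML X"
| "a \<in> classical_ML X \<Longrightarrow> Neg a \<in> classical_ML X"
| "a \<in> classical_ML X \<Longrightarrow> b \<in> classical_ML X \<Longrightarrow> And a b \<in> classical_ML X"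
| "a \<in> classical_ML X \<Longrightarrow> b \<in> classical_ML X \<Longrightarrow> Disj a b \<in> classical_ML X"
| "a \<in> classical_ML X \<Longrightarrow> Dia a \<in> classical_ML X"
| "a \<in> classical_ML X \<Longrightarrow> Box a \<in> classical_ML X"

inductive_set dep_ML :: "'p set \<Rightarrow> 'p fm set" for X :: "'p set" where
  "p \<in> X \<Longrightarrow> Var p \<in> dep_ML X"
| "Bot \<in> dep_ML X"
| "a \<in> classical_ML X \<Longrightarrow> Neg a \<in> dep_ML X"
| "set as \<subseteq> classical_ML X \<Longrightarrow> a \<in> classical_ML X \<Longrightarrow> Dep as a \<in> dep_ML X"
| "f \<in> dep_ML X \<Longrightarrow> g \<in> dep_ML X \<Longrightarrow> And f g \<in> dep_ML X"
| "f \<in> dep_ML X \<Longrightarrow> g \<in> dep_ML X \<Longrightarrow> Disj f g \<in> dep_ML X"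
| "f \<in> dep_ML X \<Longrightarrow> Might f \<in> dep_ML X"
| "f \<in> dep_ML X \<Longrightarrow> Dia f \<in> dep_ML X"
| "f \<in> dep_ML X \<Longrightarrow> Box f \<in> dep_ML X"

inductive_set inq_ML :: "'p set \<Rightarrow> 'p fm set" for X :: "'p set" where
  "p \<in> X \<Longrightarrow> Var p \<in> inq_ML X"
| "Bot \<in> inq_ML X"
| "f \<in> inq_ML X \<Longrightarrow> g \<in> inq_ML X \<Longrightarrow> And f g \<in> inq_ML X"
| "f \<in> inq_ML X \<Longrightarrow> g \<in> inq_ML X \<Longrightarrow> Imp f g \<in> inq_ML X"
| "f \<in> inq_ML X \<Longrightarrow> g \<in> inq_ML X \<Longrightarrow> GDisj f g \<in> inq_ML X"
| "f \<in> inq_ML X \<Longrightarrow> Might f \<in> inq_ML X"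
| "f \<in> inq_ML X \<Longrightarrow> Dia f \<in> inq_ML X"
| "f \<in> inq_ML X \<Longrightarrow> Box f \<in> inq_ML X"

inductive_set imp_ML :: "'p set \<Rightarrow> 'p fm set" for X :: "'p set" where
  "p \<in> X \<Longrightarrow> Var p \<in> imp_ML X"
| "Bot \<in> imp_ML X"
| "f \<in> imp_ML X \<Longrightarrow> g \<in> imp_ML X \<Longrightarrow> And f g \<in> imp_ML X"
| "f \<in> imp_ML X \<Longrightarrow> g \<in> imp_ML X \<Longrightarrow> Imp f g \<in> imp_ML X"
| "f \<in> imp_ML X \<Longrightarrow> Might f \<in> imp_ML X"
| "f \<in> imp_ML X \<Longrightarrow> Dia f \<in> imp_ML X"
| "f \<in> imp_ML X \<Longrightarrow> Box f \<in> imp_ML X"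


section \<open>Team properties and expressive completeness\<close>

text \<open>Team properties are relative to a class \<open>K\<close> of models.\<close>

definition team_models :: "('w, 'p) kripke set \<Rightarrow> (('w, 'p) kripke \<times> 'w set) set" where
  "team_models K = {(M, t). M \<in> K \<and> t \<subseteq> worlds M}"

definition property_of ::
  "('w, 'p) kripke set \<Rightarrow> 'p fm \<Rightarrow> (('w, 'p) kripke \<times> 'w set) set" where
  "property_of K f = {(M, t) \<in> team_models K. sat M t f}"

definition convex :: "(('w, 'p) kripke \<times> 'w set) set \<Rightarrow> bool" where
  "convex P \<longleftrightarrow>
     (\<forall>M s t u. (M, s) \<in> P \<longrightarrow> (M, t) \<in> P \<longrightarrow> s \<subseteq> u \<longrightarrow> u \<subseteq> t \<longrightarrow> (M, u) \<in> P)"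

definition bounded_bisim_invariant ::
  "('w, 'p) kripke set \<Rightarrow> 'p set \<Rightarrow> (('w, 'p) kripke \<times> 'w set) set \<Rightarrow> bool" where
  "bounded_bisim_invariant K X P \<longleftrightarrow>
     (\<exists>k. \<forall>(M, t)\<in>team_models K. \<forall>(M', t')\<in>team_models K.
        (M, t) \<in> P \<longrightarrow> team_bisim X k M t M' t' \<longrightarrow> (M', t') \<in> P)"

definition convex_invariant_properties ::
  "('w, 'p) kripke set \<Rightarrow> 'p set \<Rightarrow> (('w, 'p) kripke \<times> 'w set) set set" where
  "convex_invariant_properties K X =
     {P. P \<subseteq> team_models K \<and> convex P \<and> bounded_bisim_invariant K X P}"

definition expressively_complete ::
  "('w, 'p) kripke set \<Rightarrow> 'p set \<Rightarrow> 'p fm set \<Rightarrow> bool" where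
  "expressively_complete K X L \<longleftrightarrow> property_of K ` L = convex_invariant_properties K X"

definition same_types :: "'p set \<Rightarrow> ('w, 'p) kripke set \<Rightarrow> bool" where
  "same_types X K \<longleftrightarrow>
     (\<forall>M\<in>K. \<forall>M'\<in>K. \<forall>k. team_bisim X k M (worlds M) M' (worlds M'))"

text \<open>Since \<open>Disj\<close> and \<open>GDisj\<close> quantify over arbitrary teams of the model, they can detect worlds
  outside the team, such as a world satisfying \<open>p\<close>; team bisimilarity does not see those worlds.
  Hence the two logics with such a disjunction define properties of Kripke models that are not
  bisimulation invariant, and for them the inclusion of the definable properties in the invariant
  ones is only available on classes of models that realise the same bounded bisimulation types
  (in particular on every single model).\<close>

lemma dotted_disjunctions_not_invariant:
  fixes a b :: 'w and X :: "'p set"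
  assumes "a \<noteq> b" and p: "p \<in> X"
  shows "\<not> expressively_complete (kripke_models :: ('w, 'p) kripke set) X (dep_ML X)"
    and "\<not> expressively_complete (kripke_models :: ('w, 'p) kripke set) X (inq_ML X)"
proof -
  define M :: "('w, 'p) kripke" where "M = \<lparr>worlds = {a}, acc = {}, val = \<lambda>_. {}\<rparr>"
  define N :: "('w, 'p) kripke" where "N = \<lparr>worlds = {a, b}, acc = {}, val = \<lambda>_. {b}\<rparr>"
  let ?K = "kripke_models :: ('w, 'p) kripke set"
  have tm: "(M, {a}) \<in> team_models ?K" "(N, {a}) \<in> team_models ?K"
    by (auto simp: M_def N_def team_models_def kripke_models_def)
  have "bisim X k N a M a" for k
    using \<open>a \<noteq> b\<close> by (cases k) (auto simp: M_def N_def succs_def)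
  then have bis: "team_bisim X k N {a} M {a}" for k
    by (simp add: team_bisim_def)
  have key: "\<not> expressively_complete ?K X L" if "f \<in> L" "sat N {a} f" "\<not> sat M {a} f" for f L
  proof
    assume "expressively_complete ?K X L"
    then have "bounded_bisim_invariant ?K X (property_of ?K f)"
      using that(1) by (auto simp: expressively_complete_def convex_invariant_properties_def)
    then obtain k where "\<forall>(M, t)\<in>team_models ?K. \<forall>(M', t')\<in>team_models ?K.
        (M, t) \<in> property_of ?K f \<longrightarrow> team_bisim X k M t M' t' \<longrightarrow> (M', t') \<in> property_of ?K f"
      by (auto simp: bounded_bisim_invariant_def)
    then have "(N, {a}) \<in> property_of ?K f \<longrightarrow> team_bisim X k N {a} M {a} \<longrightarrow> (M, {a}) \<in> property_of ?K f"
      using tm by blast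
    then show False
      using that(2,3) tm bis by (auto simp: property_of_def)
  qed
  show "\<not> expressively_complete ?K X (dep_ML X)"
  proof (rule key)
    show "Disj (Might (Var p)) (Neg Bot) \<in> dep_ML X"
      using p by (intro dep_ML.intros classical_ML.intros)
    show "sat N {a} (Disj (Might (Var p)) (Neg Bot))"
      unfolding sat.simps by (rule exI[of _ "{b}"], rule exI[of _ "{a}"]) (auto simp: N_def)
    show "\<not> sat M {a} (Disj (Might (Var p)) (Neg Bot))"
      by (auto simp: M_def)
  qed
  show "\<not> expressively_complete ?K X (inq_ML X)"
  proof (rule key)
    show "GDisj (Might (Var p)) Bot \<in> inq_ML X"
      using p by (intro inq_ML.intros)
    show "sat N {a} (GDisj (Might (Var p)) Bot)"
      unfolding sat.simps by (rule exI[of _ "{a, b}"]) (auto simp: N_def)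
    show "\<not> sat M {a} (GDisj (Might (Var p)) Bot)"
      by (auto simp: M_def)
  qed
qed

end

theory Submission
  imports Defs
begin

text \<open>Boundedly bisimilar worlds are those satisfying the same formulas of a suitable finite set of
  flat formulas, so a team is described, up to bounded bisimulation, by the finite set of types of
  its worlds. An invariant property is convex iff it is the intersection of its upward and its
  downward closure. A set of teams that is upward closed in the types is the conjunction, over all
  type sets \<open>B\<close> outside it, of the requirement that some type outside \<open>B\<close> occurs, which is
  \<open>Might\<close> of a flat formula. A downward closed one is the conjunction, over all type sets \<open>A\<close>
  outside it, of the requirement that some type in \<open>A\<close> is omitted. The latter is expressed with
  \<open>Imp\<close> as the negation of a conjunction of \<open>Might\<close>s, and with dependence atoms by splitting
  the team into worlds with types outside \<open>A\<close> and fewer than \<open>card A\<close> pieces of constant type.\<close>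

section \<open>Convexity and invariance of definable properties\<close>

text \<open>Every connective except \<open>And\<close> and \<open>Might\<close> yields a downward
  closed property whatever its arguments are; for \<open>Disj\<close> and \<open>GDisj\<close> this
  is because their witnesses only have to cover the team. \<open>Might\<close> yields an upward
  closed one. Only \<open>And\<close> relies on the induction hypothesis.\<close>

lemma sat_convex:
  assumes "sat M s f" "sat M t f" "s \<subseteq> u" "u \<subseteq> t"
  shows "sat M u f"
  using assms
proof (induction f arbitrary: s t u)
  case (Dep as a)
  then have "v \<in> t" if "v \<in> u" for v
    using that by blast
  then show ?case
    using Dep.prems(2) by simp
next
  case (And f g)
  then show ?case
    unfolding sat.simps by blast
next
  case (Disj f g)
  then show ?case
    unfolding sat.simps by (meson subset_trans)
next
  case (GDisj f g)
  then show ?case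
    unfolding sat.simps by (meson subset_trans)
next
  case (Imp f g)
  then show ?case
    unfolding sat.simps by (meson subset_trans)
next
  case (Might f)
  then show ?case
    unfolding sat.simps by (meson subset_trans)
next
  case (Neg f)
  show ?case
    using Neg.prems(2,4) unfolding sat.simps by (meson subsetD)
next
  case (Dia f)
  show ?case
    using Dia.prems(2,4) unfolding sat.simps by (meson subsetD)
next
  case (Box f)
  show ?case
    using Box.prems(2,4) unfolding sat.simps by (meson subsetD)
qed auto

lemma convex_property_of: "convex (property_of K f)"
  unfolding convex_def property_of_def team_models_def
  by (auto intro: sat_convex)

section \<open>Bounded bisimulation of worlds and teams\<close>

lemma bisim_sym: "bisim X k M w M' w' \<Longrightarrow> bisim X k M' w' M w"
proof (induction k arbitrary: w w')
  case (Suc k)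
  then show ?case
    unfolding bisim.simps by blast
qed auto

lemma bisim_Suc_le: "bisim X (Suc k) M w M' w' \<Longrightarrow> bisim X k M w M' w'"
proof (induction k arbitrary: w w')
  case (Suc k)
  then show ?case
    by (subst bisim.simps, subst (asm) bisim.simps) blast
qed auto

lemma bisim_le: "k \<le> m \<Longrightarrow> bisim X m M w M' w' \<Longrightarrow> bisim X k M w M' w'"
  by (induction m rule: dec_induct) (auto dest: bisim_Suc_le simp del: bisim.simps)

lemma team_bisim_sym: "team_bisim X k M t M' t' \<Longrightarrow> team_bisim X k M' t' M t"
  unfolding team_bisim_def by (meson bisim_sym)

lemma team_bisim_le: "k \<le> m \<Longrightarrow> team_bisim X m M t M' t' \<Longrightarrow> team_bisim X k M t M' t'"
  unfolding team_bisim_def by (meson bisim_le)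

lemma team_bisim_singleton: "team_bisim X k M {w} M' {w'} \<longleftrightarrow> bisim X k M w M' w'"
  by (simp add: team_bisim_def)

lemma team_bisim_succs:
  "bisim X (Suc k) M w M' w' \<Longrightarrow> team_bisim X k M (succs M w) M' (succs M' w')"
  by (simp add: team_bisim_def)

lemma team_bisim_empty: "team_bisim X k M t M' t' \<Longrightarrow> t = {} \<longleftrightarrow> t' = {}"
  unfolding team_bisim_def by blast

text \<open>Transfers the subteams over which \<open>Imp\<close>, \<open>Might\<close> and
  \<open>Dia\<close> quantify: collect everything in \<open>t'\<close> that is bisimilar to some
  world of \<open>s\<close>.\<close>

lemma team_bisim_subteam:
  assumes "team_bisim X k M t M' t'" "s \<subseteq> t"
  obtains s' where "s' \<subseteq> t'" "team_bisim X k M s M' s'"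
proof
  show "{w' \<in> t'. \<exists>w\<in>s. bisim X k M w M' w'} \<subseteq> t'"
    by blast
  show "team_bisim X k M s M' {w' \<in> t'. \<exists>w\<in>s. bisim X k M w M' w'}"
    using assms unfolding team_bisim_def by blast
qed

lemma succs_subset: "K \<subseteq> kripke_models \<Longrightarrow> M \<in> K \<Longrightarrow> succs M w \<subseteq> worlds M"
  unfolding kripke_models_def succs_def by auto

text \<open>One implication suffices, since the roles of the two teams can be exchanged by symmetry
  of \<open>team_bisim\<close>. The depth is explicit because each modality raises it.\<close>

definition invariant_upto ::
  "('w, 'p) kripke set \<Rightarrow> 'p set \<Rightarrow> nat \<Rightarrow> 'p fm \<Rightarrow> bool" where
  "invariant_upto K X k f \<longleftrightarrow>
     (\<forall>M\<in>K. \<forall>M'\<in>K. \<forall>t t'. t \<subseteq> worlds M \<longrightarrow> t' \<subseteq> worlds M' \<longrightarrow> team_bisim X k M t M' t' \<longrightarrow>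
        sat M t f \<longrightarrow> sat M' t' f)"

lemma invariant_uptoI:
  assumes "\<And>M M' t t'. \<lbrakk>M \<in> K; M' \<in> K; t \<subseteq> worlds M; t' \<subseteq> worlds M'; team_bisim X k M t M' t';
      sat M t f\<rbrakk> \<Longrightarrow> sat M' t' f"
  shows "invariant_upto K X k f"
  using assms unfolding invariant_upto_def by blast

lemma invariant_uptoD:
  assumes "invariant_upto K X k f" "M \<in> K" "M' \<in> K" "t \<subseteq> worlds M" "t' \<subseteq> worlds M'"
    "team_bisim X k M t M' t'"
  shows "sat M t f \<longleftrightarrow> sat M' t' f"
  using assms team_bisim_sym[of X k M t M' t'] unfolding invariant_upto_def by blast

lemma invariant_upto_le: "k \<le> m \<Longrightarrow> invariant_upto K X k f \<Longrightarrow> invariant_upto K X m f"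
  unfolding invariant_upto_def by (meson team_bisim_le)

text \<open>Invariance persists at every larger depth, so the maximum of two depths serves both
  formulas.\<close>

lemma invariant_upto_common:
  assumes "\<exists>k. invariant_upto K X k f" "\<exists>k. invariant_upto K X k g"
  obtains k where "invariant_upto K X k f" "invariant_upto K X k g"
  using assms by (meson invariant_upto_le max.cobounded1 max.cobounded2)

lemma invariant_upto_common_list:
  assumes "\<forall>f\<in>set fs. \<exists>k. invariant_upto K X k f"
  shows "\<exists>k. \<forall>f\<in>set fs. invariant_upto K X k f"
  using assms
proof (induction fs)
  case (Cons f fs)
  then obtain k m where "invariant_upto K X k f" "\<forall>g\<in>set fs. invariant_upto K X m g"
    by auto
  then have "\<forall>g\<in>set (f # fs). invariant_upto K X (max k m) g"
    by (auto intro: invariant_upto_le[rotated])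
  then show ?case
    by blast
qed simp

section \<open>Preservation of invariance, connective by connective\<close>

lemma invariant_Var:
  assumes "p \<in> X"
  shows "\<exists>k. invariant_upto K X k (Var p)"
proof
  show "invariant_upto K X 0 (Var p)"
    using assms by (intro invariant_uptoI) (simp add: team_bisim_def, blast)
qed

lemma invariant_Bot: "\<exists>k. invariant_upto K X k Bot"
proof
  show "invariant_upto K X 0 Bot"
    by (intro invariant_uptoI) (auto dest: team_bisim_empty)
qed

text \<open>The case of singleton teams, needed for \<open>Neg\<close> and \<open>Dep\<close>, which
  evaluate their arguments at worlds.\<close>

lemma invariant_upto_world:
  assumes "invariant_upto K X k f" "M \<in> K" "M' \<in> K" "w \<in> worlds M" "w' \<in> worlds M'"
    "bisim X k M w M' w'"
  shows "sat M {w} f \<longleftrightarrow> sat M' {w'} f"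
  using invariant_uptoD[OF assms(1-3), of "{w}" "{w'}"] assms(4-6) by (simp add: team_bisim_singleton)

lemma invariant_Neg:
  assumes "\<exists>k. invariant_upto K X k a"
  shows "\<exists>k. invariant_upto K X k (Neg a)"
proof -
  from assms obtain k where k: "invariant_upto K X k a" ..
  have "invariant_upto K X k (Neg a)"
  proof (rule invariant_uptoI)
    fix M M' t t'
    assume *: "M \<in> K" "M' \<in> K" "t \<subseteq> worlds M" "t' \<subseteq> worlds M'" "team_bisim X k M t M' t'"
      "sat M t (Neg a)"
    show "sat M' t' (Neg a)"
      unfolding sat.simps
    proof
      fix w' assume "w' \<in> t'"
      with * obtain w where "w \<in> t" "bisim X k M w M' w'"
        unfolding team_bisim_def by blast
      with * \<open>w' \<in> t'\<close> invariant_upto_world[OF k, of M M' w w'] show "\<not> sat M' {w'} a"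
        by auto
    qed
  qed
  then show ?thesis ..
qed

lemma invariant_Dep:
  assumes "\<forall>b\<in>set as. \<exists>k. invariant_upto K X k b" "\<exists>k. invariant_upto K X k a"
  shows "\<exists>k. invariant_upto K X k (Dep as a)"
proof -
  from assms obtain k where k: "\<forall>b\<in>set (a # as). invariant_upto K X k b"
    using invariant_upto_common_list[of "a # as" K X] by auto
  have "invariant_upto K X k (Dep as a)"
  proof (rule invariant_uptoI)
    fix M M' t t'
    assume *: "M \<in> K" "M' \<in> K" "t \<subseteq> worlds M" "t' \<subseteq> worlds M'" "team_bisim X k M t M' t'"
      "sat M t (Dep as a)"
    \<comment> \<open>Every world of \<open>t'\<close> has a twin in \<open>t\<close> agreeing on
      all formulas of the atom, so a violation of the dependence in \<open>t'\<close> would give one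
      in \<open>t\<close>.\<close>
    have ex: "\<exists>w\<in>t. \<forall>b\<in>set (a # as). sat M {w} b \<longleftrightarrow> sat M' {w'} b" if w': "w' \<in> t'" for w'
    proof -
      from * w' obtain w where w: "w \<in> t" "bisim X k M w M' w'"
        unfolding team_bisim_def by blast
      then have "\<forall>b\<in>set (a # as). sat M {w} b \<longleftrightarrow> sat M' {w'} b"
        using invariant_upto_world[of K X k _ M M' w w'] k * w' by blast
      with w show ?thesis
        by blast
    qed
    show "sat M' t' (Dep as a)"
      unfolding sat.simps
    proof (intro ballI impI)
      fix v' w'
      assume v': "v' \<in> t'" and w': "w' \<in> t'" and agree: "\<forall>b\<in>set as. sat M' {v'} b \<longleftrightarrow> sat M' {w'} b"
      obtain v where v: "v \<in> t" "\<forall>b\<in>set (a # as). sat M {v} b \<longleftrightarrow> sat M' {v'} b"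
        using ex[OF v'] by blast
      obtain w where w: "w \<in> t" "\<forall>b\<in>set (a # as). sat M {w} b \<longleftrightarrow> sat M' {w'} b"
        using ex[OF w'] by blast
      have "\<forall>b\<in>set as. sat M {v} b \<longleftrightarrow> sat M {w} b"
        using agree v w by auto
      then have "sat M {v} a \<longleftrightarrow> sat M {w} a"
        using *(6) v(1) w(1) unfolding sat.simps by blast
      then show "sat M' {v'} a \<longleftrightarrow> sat M' {w'} a"
        using v(2) w(2) by (metis list.set_intros(1))
    qed
  qed
  then show ?thesis ..
qed

lemma invariant_And:
  assumes "\<exists>k. invariant_upto K X k f" "\<exists>k. invariant_upto K X k g"
  shows "\<exists>k. invariant_upto K X k (And f g)"
proof -
  from assms obtain k where k: "invariant_upto K X k f" "invariant_upto K X k g"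
    using invariant_upto_common by blast
  have "invariant_upto K X k (And f g)"
    by (rule invariant_uptoI) (simp add: invariant_uptoD[OF k(1)] invariant_uptoD[OF k(2)])
  then show ?thesis ..
qed

lemma invariant_Imp:
  assumes "\<exists>k. invariant_upto K X k f" "\<exists>k. invariant_upto K X k g"
  shows "\<exists>k. invariant_upto K X k (Imp f g)"
proof -
  from assms obtain k where k: "invariant_upto K X k f" "invariant_upto K X k g"
    using invariant_upto_common by blast
  have "invariant_upto K X k (Imp f g)"
  proof (rule invariant_uptoI)
    fix M M' t t'
    assume *: "M \<in> K" "M' \<in> K" "t \<subseteq> worlds M" "t' \<subseteq> worlds M'" "team_bisim X k M t M' t'"
      "sat M t (Imp f g)"
    show "sat M' t' (Imp f g)"
      unfolding sat.simps
    proof (intro allI impI)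
      fix s' assume s': "s' \<subseteq> t'" "sat M' s' f"
      \<comment> \<open>The subteam is pulled back to \<open>t\<close>, where the implication is
        assumed; its conclusion then travels forward again.\<close>
      obtain s where s: "s \<subseteq> t" "team_bisim X k M' s' M s"
        using team_bisim_subteam[OF team_bisim_sym[OF *(5)] s'(1)] .
      have sub: "s' \<subseteq> worlds M'" "s \<subseteq> worlds M"
        using s s' * by auto
      show "sat M' s' g"
        using invariant_uptoD[OF k(1) *(2,1) sub s(2)] invariant_uptoD[OF k(2) *(2,1) sub s(2)]
          s s' *(6) by auto
    qed
  qed
  then show ?thesis ..
qed

lemma invariant_Might:
  assumes "\<exists>k. invariant_upto K X k f"
  shows "\<exists>k. invariant_upto K X k (Might f)"
proof -
  from assms obtain k where k: "invariant_upto K X k f" ..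
  have "invariant_upto K X k (Might f)"
  proof (rule invariant_uptoI)
    fix M M' t t'
    assume *: "M \<in> K" "M' \<in> K" "t \<subseteq> worlds M" "t' \<subseteq> worlds M'" "team_bisim X k M t M' t'"
      "sat M t (Might f)"
    then obtain s where s: "s \<noteq> {}" "s \<subseteq> t" "sat M s f"
      by auto
    obtain s' where s': "s' \<subseteq> t'" "team_bisim X k M s M' s'"
      using team_bisim_subteam[OF *(5) s(2)] .
    have sub: "s \<subseteq> worlds M" "s' \<subseteq> worlds M'"
      using s s' * by auto
    show "sat M' t' (Might f)"
      using invariant_uptoD[OF k *(1,2) sub s'(2)] team_bisim_empty[OF s'(2)] s s' by auto
  qed
  then show ?thesis ..
qed

lemma invariant_Dia:
  assumes K: "K \<subseteq> kripke_models" and "\<exists>k. invariant_upto K X k f"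
  shows "\<exists>k. invariant_upto K X k (Dia f)"
proof -
  from assms obtain k where k: "invariant_upto K X k f"
    by blast
  \<comment> \<open>One level of depth pays for the step to successors, whose teams are then
    bisimilar to depth \<open>k\<close>.\<close>
  have "invariant_upto K X (Suc k) (Dia f)"
  proof (rule invariant_uptoI)
    fix M M' t t'
    assume *: "M \<in> K" "M' \<in> K" "t \<subseteq> worlds M" "t' \<subseteq> worlds M'" "team_bisim X (Suc k) M t M' t'"
      "sat M t (Dia f)"
    show "sat M' t' (Dia f)"
      unfolding sat.simps(10)
    proof
      fix w' assume "w' \<in> t'"
      then obtain w where w: "w \<in> t" "bisim X (Suc k) M w M' w'"
        using *(5) unfolding team_bisim_def by blast
      then obtain s where s: "s \<noteq> {}" "s \<subseteq> succs M w" "sat M s f"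
        using *(6) unfolding sat.simps by blast
      obtain s' where s': "s' \<subseteq> succs M' w'" "team_bisim X k M s M' s'"
        using team_bisim_subteam[OF team_bisim_succs[OF w(2)] s(2)] .
      have sub: "s \<subseteq> worlds M" "s' \<subseteq> worlds M'"
        using s(2) s'(1) succs_subset[OF K *(1)] succs_subset[OF K *(2)] by (meson subset_trans)+
      show "\<exists>s\<noteq>{}. s \<subseteq> succs M' w' \<and> sat M' s f"
        using invariant_uptoD[OF k *(1,2) sub s'(2)] team_bisim_empty[OF s'(2)] s s' by auto
    qed
  qed
  then show ?thesis ..
qed

lemma invariant_Box:
  assumes K: "K \<subseteq> kripke_models" and "\<exists>k. invariant_upto K X k f"
  shows "\<exists>k. invariant_upto K X k (Box f)"
proof -
  from assms obtain k where k: "invariant_upto K X k f"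
    by blast
  have "invariant_upto K X (Suc k) (Box f)"
  proof (rule invariant_uptoI)
    fix M M' t t'
    assume *: "M \<in> K" "M' \<in> K" "t \<subseteq> worlds M" "t' \<subseteq> worlds M'" "team_bisim X (Suc k) M t M' t'"
      "sat M t (Box f)"
    show "sat M' t' (Box f)"
      unfolding sat.simps(11)
    proof
      fix w' assume "w' \<in> t'"
      then obtain w where w: "w \<in> t" "bisim X (Suc k) M w M' w'"
        using *(5) unfolding team_bisim_def by blast
      have sub: "succs M w \<subseteq> worlds M" "succs M' w' \<subseteq> worlds M'"
        using succs_subset[OF K *(1)] succs_subset[OF K *(2)] by auto
      show "sat M' (succs M' w') f"
        using invariant_uptoD[OF k *(1,2) sub team_bisim_succs[OF w(2)]] w(1) *(6) by simp
    qed
  qed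
  then show ?thesis ..
qed

text \<open>The witnessing teams may leave \<open>t\<close>, so bisimilarity of the two teams cannot
  transfer them. They are copied along the bisimilarity of the full world sets that
  \<open>same_types\<close> provides.\<close>

lemma invariant_Disj:
  assumes types: "same_types X K"
    and "\<exists>k. invariant_upto K X k f" "\<exists>k. invariant_upto K X k g"
  shows "\<exists>k. invariant_upto K X k (Disj f g)"
proof -
  from assms obtain k where k: "invariant_upto K X k f" "invariant_upto K X k g"
    using invariant_upto_common by blast
  have "invariant_upto K X k (Disj f g)"
  proof (rule invariant_uptoI)
    fix M M' t t'
    assume *: "M \<in> K" "M' \<in> K" "t \<subseteq> worlds M" "t' \<subseteq> worlds M'" "team_bisim X k M t M' t'"
      "sat M t (Disj f g)"
    then obtain s u where su: "s \<subseteq> worlds M" "u \<subseteq> worlds M" "t \<subseteq> s \<union> u" "sat M s f" "sat M u g"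
      by auto
    have tw: "team_bisim X k M (worlds M) M' (worlds M')"
      using types * unfolding same_types_def by blast
    \<comment> \<open>All worlds of \<open>M'\<close> bisimilar to some world of \<open>r\<close>.
      Taking all of them, not one per world, makes the copies cover \<open>t'\<close>.\<close>
    define cp where "cp r = {w' \<in> worlds M'. \<exists>w\<in>r. bisim X k M w M' w'}" for r
    have cp: "cp r \<subseteq> worlds M'" "r \<subseteq> worlds M \<Longrightarrow> team_bisim X k M r M' (cp r)" for r
      using tw unfolding cp_def team_bisim_def by blast+
    have "t' \<subseteq> cp s \<union> cp u"
    proof
      fix w' assume "w' \<in> t'"
      moreover from this obtain w where "w \<in> t" "bisim X k M w M' w'"
        using *(5) unfolding team_bisim_def by blast
      ultimately show "w' \<in> cp s \<union> cp u"
        using su(3) *(4) unfolding cp_def by blast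
    qed
    moreover have "sat M' (cp s) f" "sat M' (cp u) g"
      using invariant_uptoD[OF k(1) *(1,2) su(1) cp(1) cp(2)[OF su(1)]]
        invariant_uptoD[OF k(2) *(1,2) su(2) cp(1) cp(2)[OF su(2)]] su by auto
    ultimately show "sat M' t' (Disj f g)"
      unfolding sat.simps using cp(1) by (intro exI[of _ "cp s"] exI[of _ "cp u"]) simp
  qed
  then show ?thesis ..
qed

lemma invariant_GDisj:
  assumes types: "same_types X K"
    and "\<exists>k. invariant_upto K X k f" "\<exists>k. invariant_upto K X k g"
  shows "\<exists>k. invariant_upto K X k (GDisj f g)"
proof -
  from assms obtain k where k: "invariant_upto K X k f" "invariant_upto K X k g"
    using invariant_upto_common by blast
  have "invariant_upto K X k (GDisj f g)"
  proof (rule invariant_uptoI)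
    fix M M' t t'
    assume *: "M \<in> K" "M' \<in> K" "t \<subseteq> worlds M" "t' \<subseteq> worlds M'" "team_bisim X k M t M' t'"
      "sat M t (GDisj f g)"
    then obtain s where s: "s \<subseteq> worlds M" "t \<subseteq> s" "sat M s f \<or> sat M s g"
      by auto
    have tw: "team_bisim X k M (worlds M) M' (worlds M')"
      using types * unfolding same_types_def by blast
    define s' where "s' = {w' \<in> worlds M'. \<exists>w\<in>s. bisim X k M w M' w'}"
    have s': "s' \<subseteq> worlds M'" "team_bisim X k M s M' s'"
      using tw s(1) unfolding s'_def team_bisim_def by blast+
    have "t' \<subseteq> s'"
      using *(4,5) s(2) unfolding s'_def team_bisim_def by blast
    moreover have "sat M' s' f \<or> sat M' s' g"
      using invariant_uptoD[OF k(1) *(1,2) s(1) s'] invariant_uptoD[OF k(2) *(1,2) s(1) s'] s(3)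
      by blast
    ultimately show "sat M' t' (GDisj f g)"
      unfolding sat.simps using s'(1) by blast
  qed
  then show ?thesis ..
qed

section \<open>Soundness: formulas of the logics define convex invariant properties\<close>

lemma imp_ML_invariant:
  assumes "K \<subseteq> kripke_models" "f \<in> imp_ML X"
  shows "\<exists>k. invariant_upto K X k f"
  using assms(2)
  by induction (intro invariant_Var invariant_Bot invariant_And invariant_Imp invariant_Might
      invariant_Dia[OF assms(1)] invariant_Box[OF assms(1)]; assumption)+

lemma inq_ML_invariant:
  assumes "K \<subseteq> kripke_models" "same_types X K" "f \<in> inq_ML X"
  shows "\<exists>k. invariant_upto K X k f"
  using assms(3)
  by induction (intro invariant_Var invariant_Bot invariant_And invariant_Imp invariant_Might
      invariant_GDisj[OF assms(2)] invariant_Dia[OF assms(1)] invariant_Box[OF assms(1)]; assumption)+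

text \<open>Supplies the invariance of the arguments of \<open>Neg\<close> and \<open>Dep\<close> in
  \<open>dep_ML\<close>.\<close>

lemma classical_ML_invariant:
  assumes "K \<subseteq> kripke_models" "same_types X K" "f \<in> classical_ML X"
  shows "\<exists>k. invariant_upto K X k f"
  using assms(3)
  by induction (intro invariant_Var invariant_Bot invariant_And invariant_Neg
      invariant_Disj[OF assms(2)] invariant_Dia[OF assms(1)] invariant_Box[OF assms(1)]; assumption)+

lemma dep_ML_invariant:
  assumes "K \<subseteq> kripke_models" "same_types X K" "f \<in> dep_ML X"
  shows "\<exists>k. invariant_upto K X k f"
  using assms(3)
proof induction
  case (3 a)
  then show ?case
    using classical_ML_invariant[OF assms(1,2)] by (intro invariant_Neg)
next
  case (4 as a)
  then show ?case
    using classical_ML_invariant[OF assms(1,2)] by (intro invariant_Dep) auto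
qed (intro invariant_Var invariant_Bot invariant_And invariant_Might invariant_Disj[OF assms(2)]
    invariant_Dia[OF assms(1)] invariant_Box[OF assms(1)]; assumption)+

lemma property_of_convex_invariant:
  assumes "\<exists>k. invariant_upto K X k f"
  shows "property_of K f \<in> convex_invariant_properties K X"
proof -
  from assms obtain k where k: "invariant_upto K X k f" ..
  have "\<forall>(M, t)\<in>team_models K. \<forall>(M', t')\<in>team_models K. (M, t) \<in> property_of K f \<longrightarrow>
      team_bisim X k M t M' t' \<longrightarrow> (M', t') \<in> property_of K f"
    using k unfolding invariant_upto_def property_of_def team_models_def by auto
  then show ?thesis
    unfolding convex_invariant_properties_def bounded_bisim_invariant_def
    using convex_property_of[of K f] by (auto simp: property_of_def)
qed


section \<open>Types of worlds and flat formulas\<close>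

text \<open>A syntactic stand-in for the bounded bisimulation class of a world. Types over a finite
  \<open>F\<close> lie in the finite set \<open>Pow F\<close> and can be compared across
  models.\<close>

definition type_of :: "'p fm set \<Rightarrow> ('w, 'p) kripke \<Rightarrow> 'w \<Rightarrow> 'p fm set" where
  "type_of F M w = {a \<in> F. sat M {w} a}"

text \<open>The right-hand side has the shape of the back-and-forth conditions, so bisimilarity of
  teams becomes equality of their sets of types.\<close>

lemma image_eq_image_iff:
  "g ` A = h ` B \<longleftrightarrow> (\<forall>v\<in>A. \<exists>v'\<in>B. g v = h v') \<and> (\<forall>v'\<in>B. \<exists>v\<in>A. g v = h v')"
  by (auto simp: set_eq_iff image_iff) metis+

lemma finite_types: "finite F \<Longrightarrow> finite (type_of F M ` t)"
  by (rule finite_subset[of _ "Pow F"]) (auto simp: type_of_def)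

lemma type_of_insert:
  "type_of (insert a F) M w = (if sat M {w} a then insert a (type_of F M w) else type_of F M w)"
  by (auto simp: type_of_def)

lemma type_of_eq_iff: "type_of F M w = type_of F N v \<longleftrightarrow> (\<forall>a\<in>F. sat M {w} a \<longleftrightarrow> sat N {v} a)"
  by (auto simp: type_of_def)

section \<open>Flat formulas\<close>

definition flat_on :: "('w, 'p) kripke set \<Rightarrow> 'p fm \<Rightarrow> bool" where
  "flat_on K f \<longleftrightarrow> (\<forall>M\<in>K. \<forall>t\<subseteq>worlds M. sat M t f \<longleftrightarrow> (\<forall>w\<in>t. sat M {w} f))"

lemma flat_onD: "flat_on K f \<Longrightarrow> M \<in> K \<Longrightarrow> t \<subseteq> worlds M \<Longrightarrow> sat M t f \<longleftrightarrow> (\<forall>w\<in>t. sat M {w} f)"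
  unfolding flat_on_def by blast

text \<open>Any world condition \<open>Q\<close> may be used: the singleton case forces it to
  coincide with truth of \<open>f\<close> at the world.\<close>

lemma flat_onI:
  assumes "\<And>M t. M \<in> K \<Longrightarrow> t \<subseteq> worlds M \<Longrightarrow> sat M t f \<longleftrightarrow> (\<forall>w\<in>t. Q M w)"
  shows "flat_on K f"
  unfolding flat_on_def
proof (intro ballI allI impI)
  fix M t assume M: "M \<in> K" "t \<subseteq> worlds M"
  then have "sat M {w} f \<longleftrightarrow> Q M w" if "w \<in> t" for w
    using assms[of M "{w}"] that by auto
  then show "sat M t f \<longleftrightarrow> (\<forall>w\<in>t. sat M {w} f)"
    using assms[OF M] by simp
qed

lemma sat_Might_flat:
  assumes "flat_on K f" "M \<in> K" "t \<subseteq> worlds M"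
  shows "sat M t (Might f) \<longleftrightarrow> (\<exists>w\<in>t. sat M {w} f)"
proof
  assume "sat M t (Might f)"
  then obtain s where "s \<noteq> {}" "s \<subseteq> t" "sat M s f"
    by auto
  with flat_onD[OF assms(1,2), of s] assms(3) show "\<exists>w\<in>t. sat M {w} f"
    by blast
next
  assume "\<exists>w\<in>t. sat M {w} f"
  then obtain w where "w \<in> t" "sat M {w} f"
    by blast
  then show "sat M t (Might f)"
    by (auto intro!: exI[of _ "{w}"])
qed

text \<open>At a single world, \<open>Dia f\<close> is \<open>Might f\<close> evaluated on the team
  of successors.\<close>

lemma sat_world_Dia_flat:
  assumes "flat_on K f" "M \<in> K" "K \<subseteq> kripke_models"
  shows "sat M {w} (Dia f) \<longleftrightarrow> (\<exists>v\<in>succs M w. sat M {v} f)"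
  using sat_Might_flat[OF assms(1,2) succs_subset[OF assms(3,2)], of w] by simp

lemma flat_on_Dia: "flat_on K (Dia f)"
  unfolding flat_on_def by simp

text \<open>The interface shared by the logics: \<open>L\<close> is the whole logic and
  \<open>C\<close> a flat part playing the role of classical modal logic. Negation is required only
  semantically, so that \<open>Neg\<close> and \<open>Imp _ Bot\<close> both provide it.\<close>

locale flat_fragment =
  fixes K :: "('w, 'p) kripke set" and X :: "'p set" and C L :: "'p fm set"
  assumes models: "K \<subseteq> kripke_models"
    and flat_subset: "C \<subseteq> L"
    and flat: "a \<in> C \<Longrightarrow> flat_on K a"
    and Var_flat: "p \<in> X \<Longrightarrow> Var p \<in> C"
    and Bot_flat: "Bot \<in> C"
    and And_flat: "a \<in> C \<Longrightarrow> b \<in> C \<Longrightarrow> And a b \<in> C"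
    and Dia_flat: "a \<in> C \<Longrightarrow> Dia a \<in> C"
    and neg_flat: "a \<in> C \<Longrightarrow> \<exists>b\<in>C. \<forall>M\<in>K. \<forall>w\<in>worlds M. sat M {w} b \<longleftrightarrow> \<not> sat M {w} a"
    and And_closed: "f \<in> L \<Longrightarrow> g \<in> L \<Longrightarrow> And f g \<in> L"
    and Might_closed: "f \<in> L \<Longrightarrow> Might f \<in> L"
begin

section \<open>Characteristic formulas and definability inside the fragment\<close>

lemma top_flat: obtains a where "a \<in> C" "\<And>M t. M \<in> K \<Longrightarrow> t \<subseteq> worlds M \<Longrightarrow> sat M t a"
proof -
  obtain a where "a \<in> C" "\<forall>M\<in>K. \<forall>w\<in>worlds M. sat M {w} a \<longleftrightarrow> \<not> sat M {w} Bot"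
    using neg_flat[OF Bot_flat] by blast
  moreover from this have "sat M t a" if "M \<in> K" "t \<subseteq> worlds M" for M t
    using flat_onD[OF flat that] that by auto
  ultimately show ?thesis
    using that by blast
qed

text \<open>Obtained by De Morgan, because the implicational logic has no disjunction of its
  own.\<close>

lemma disj_flat:
  assumes "a \<in> C" "b \<in> C"
  shows "\<exists>c\<in>C. \<forall>M\<in>K. \<forall>w\<in>worlds M. sat M {w} c \<longleftrightarrow> sat M {w} a \<or> sat M {w} b"
proof -
  obtain a' where a': "a' \<in> C" "\<forall>M\<in>K. \<forall>w\<in>worlds M. sat M {w} a' \<longleftrightarrow> \<not> sat M {w} a"
    using neg_flat[OF assms(1)] by blast
  obtain b' where b': "b' \<in> C" "\<forall>M\<in>K. \<forall>w\<in>worlds M. sat M {w} b' \<longleftrightarrow> \<not> sat M {w} b"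
    using neg_flat[OF assms(2)] by blast
  obtain c where "c \<in> C" "\<forall>M\<in>K. \<forall>w\<in>worlds M. sat M {w} c \<longleftrightarrow> \<not> sat M {w} (And a' b')"
    using neg_flat[OF And_flat[OF a'(1) b'(1)]] by blast
  with a' b' show ?thesis
    by auto
qed

text \<open>Shannon expansion: induction on \<open>F\<close> with \<open>T\<close> arbitrary,
  splitting on the truth of the new formula \<open>a\<close>.\<close>

lemma define_types:
  assumes "finite F" "F \<subseteq> C"
  shows "\<exists>c\<in>C. \<forall>M\<in>K. \<forall>w\<in>worlds M. sat M {w} c \<longleftrightarrow> type_of F M w \<in> T"
  using assms
proof (induction F arbitrary: T)
  case empty
  show ?case
  proof (cases "{} \<in> T")
    case True
    obtain a where "a \<in> C" "\<And>M t. M \<in> K \<Longrightarrow> t \<subseteq> worlds M \<Longrightarrow> sat M t a"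
      using top_flat by blast
    with True show ?thesis
      by (auto simp: type_of_def intro!: bexI[of _ a])
  next
    case False
    with Bot_flat show ?thesis
      by (auto simp: type_of_def intro!: bexI[of _ Bot])
  qed
next
  case (insert a F)
  then have a: "a \<in> C"
    by simp
  obtain a' where a': "a' \<in> C" "\<forall>M\<in>K. \<forall>w\<in>worlds M. sat M {w} a' \<longleftrightarrow> \<not> sat M {w} a"
    using neg_flat[OF a] by blast
  \<comment> \<open>Where \<open>a\<close> holds, the type over the larger set is obtained by
    inserting \<open>a\<close>, so the target is the preimage of \<open>T\<close>; where
    \<open>a\<close> fails, it is \<open>T\<close> itself.\<close>
  obtain b where b: "b \<in> C"
    "\<forall>M\<in>K. \<forall>w\<in>worlds M. sat M {w} b \<longleftrightarrow> type_of F M w \<in> {S. insert a S \<in> T}"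
    using insert.IH[of "{S. insert a S \<in> T}"] insert.prems by blast
  obtain b' where b': "b' \<in> C" "\<forall>M\<in>K. \<forall>w\<in>worlds M. sat M {w} b' \<longleftrightarrow> type_of F M w \<in> T"
    using insert.IH[of T] insert.prems by blast
  obtain c where "c \<in> C" "\<forall>M\<in>K. \<forall>w\<in>worlds M. sat M {w} c \<longleftrightarrow>
      sat M {w} (And a b) \<or> sat M {w} (And a' b')"
    using disj_flat[OF And_flat[OF a b(1)] And_flat[OF a'(1) b'(1)]] by blast
  with a' b b' show ?case
    by (auto simp: type_of_insert intro!: bexI[of _ c])
qed

text \<open>Conjuncts are given by the conditions \<open>Q i\<close> they express, so finite
  conjunctions can be used without naming formulas.\<close>

lemma conj_closed:
  assumes "finite I" "\<forall>i\<in>I. \<exists>f\<in>L. \<forall>M\<in>K. \<forall>t\<subseteq>worlds M. sat M t f \<longleftrightarrow> Q i M t"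
  shows "\<exists>f\<in>L. \<forall>M\<in>K. \<forall>t\<subseteq>worlds M. sat M t f \<longleftrightarrow> (\<forall>i\<in>I. Q i M t)"
  using assms
proof (induction I)
  case empty
  obtain a where "a \<in> C" "\<And>M t. M \<in> K \<Longrightarrow> t \<subseteq> worlds M \<Longrightarrow> sat M t a"
    using top_flat by blast
  then show ?case
    using flat_subset by auto
next
  case (insert i I)
  then obtain f where f: "f \<in> L" "\<forall>M\<in>K. \<forall>t\<subseteq>worlds M. sat M t f \<longleftrightarrow> (\<forall>i\<in>I. Q i M t)"
    by auto
  from insert obtain g where g: "g \<in> L" "\<forall>M\<in>K. \<forall>t\<subseteq>worlds M. sat M t g \<longleftrightarrow> Q i M t"
    by auto
  show ?case
    using f g And_closed[OF f(1) g(1)] by (intro bexI[of _ "And f g"]) auto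
qed

lemma realise_some_type:
  assumes "finite F" "F \<subseteq> C"
  shows "\<exists>f\<in>L. \<forall>M\<in>K. \<forall>t\<subseteq>worlds M. sat M t f \<longleftrightarrow> type_of F M ` t \<inter> T \<noteq> {}"
proof -
  obtain c where c: "c \<in> C" "\<forall>M\<in>K. \<forall>w\<in>worlds M. sat M {w} c \<longleftrightarrow> type_of F M w \<in> T"
    using define_types[OF assms] by blast
  have "\<forall>M\<in>K. \<forall>t\<subseteq>worlds M. sat M t (Might c) \<longleftrightarrow> type_of F M ` t \<inter> T \<noteq> {}"
  proof (intro ballI allI impI)
    fix M t assume M: "M \<in> K" "t \<subseteq> worlds M"
    show "sat M t (Might c) \<longleftrightarrow> type_of F M ` t \<inter> T \<noteq> {}"
      unfolding sat_Might_flat[OF flat[OF c(1)] M] using c(2) M by blast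
  qed
  then show ?thesis
    using Might_closed c(1) flat_subset by blast
qed

text \<open>The Hintikka formula argument. The set for depth \<open>Suc k\<close> consists of the
  atoms and, for each type \<open>S\<close> over the set for depth \<open>k\<close>, a diamond in
  front of the formula characterising \<open>S\<close>. Equality of types also records which
  diamonds fail, and so covers both directions of the bisimulation.\<close>

lemma bisim_iff_types:
  assumes "finite X"
  shows "\<exists>F\<subseteq>C. finite F \<and> (\<forall>M\<in>K. \<forall>w\<in>worlds M. \<forall>M'\<in>K. \<forall>w'\<in>worlds M'.
    bisim X k M w M' w' \<longleftrightarrow> type_of F M w = type_of F M' w')"
proof (induction k)
  case 0
  show ?case
    using assms Var_flat by (intro exI[of _ "Var ` X"]) (auto simp: type_of_eq_iff)
next
  case (Suc k)
  obtain F where F: "F \<subseteq> C" "finite F"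
    and F_bisim: "\<forall>M\<in>K. \<forall>w\<in>worlds M. \<forall>M'\<in>K. \<forall>w'\<in>worlds M'.
      bisim X k M w M' w' \<longleftrightarrow> type_of F M w = type_of F M' w'"
    using Suc.IH by (elim exE conjE) (rule that)
  have "\<exists>c\<in>C. \<forall>M\<in>K. \<forall>w\<in>worlds M. sat M {w} c \<longleftrightarrow> type_of F M w = S" for S
    using define_types[OF F(2,1), of "{S}"] by simp
  then obtain c where c: "\<And>S. c S \<in> C"
    "\<And>S M w. M \<in> K \<Longrightarrow> w \<in> worlds M \<Longrightarrow> sat M {w} (c S) \<longleftrightarrow> type_of F M w = S"
    by metis
  let ?G = "Var ` X \<union> (\<lambda>S. Dia (c S)) ` Pow F"
  have Dia: "sat M {w} (Dia (c S)) \<longleftrightarrow> S \<in> type_of F M ` succs M w" if "M \<in> K" for M w S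
  proof -
    have "v \<in> worlds M" if "v \<in> succs M w" for v
      using succs_subset[OF models \<open>M \<in> K\<close>] that by blast
    then show ?thesis
      unfolding sat_world_Dia_flat[OF flat[OF c(1)] that models] using c(2)[OF that] by blast
  qed
  have "bisim X (Suc k) M w M' w' \<longleftrightarrow> type_of ?G M w = type_of ?G M' w'"
    if M: "M \<in> K" "M' \<in> K" for M w M' w'
  proof -
    have succ: "v \<in> succs M w \<Longrightarrow> v \<in> worlds M" "v \<in> succs M' w' \<Longrightarrow> v \<in> worlds M'" for v
      using succs_subset[OF models M(1)] succs_subset[OF models M(2)] by auto
    have "bisim X (Suc k) M w M' w' \<longleftrightarrow> (\<forall>p\<in>X. w \<in> val M p \<longleftrightarrow> w' \<in> val M' p)
        \<and> (\<forall>v\<in>succs M w. \<exists>v'\<in>succs M' w'. type_of F M v = type_of F M' v')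
        \<and> (\<forall>v'\<in>succs M' w'. \<exists>v\<in>succs M w. type_of F M v = type_of F M' v')"
      by (simp add: F_bisim M succ cong: ball_cong bex_cong)
    also have "\<dots> \<longleftrightarrow> (\<forall>p\<in>X. w \<in> val M p \<longleftrightarrow> w' \<in> val M' p)
        \<and> type_of F M ` succs M w = type_of F M' ` succs M' w'"
      by (simp only: image_eq_image_iff)
    \<comment> \<open>All types are subsets of \<open>F\<close>, so the two sets of types need
      comparing only on \<open>Pow F\<close>, the index set of the diamonds in
      \<open>?G\<close>.\<close>
    also have "\<dots> \<longleftrightarrow> (\<forall>p\<in>X. w \<in> val M p \<longleftrightarrow> w' \<in> val M' p) \<and>
        (\<forall>S\<in>Pow F. S \<in> type_of F M ` succs M w \<longleftrightarrow> S \<in> type_of F M' ` succs M' w')"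
    proof -
      have eq: "A = B \<longleftrightarrow> (\<forall>S\<in>Pow F. S \<in> A \<longleftrightarrow> S \<in> B)" if "A \<subseteq> Pow F" "B \<subseteq> Pow F" for A B
        using that by blast
      show ?thesis
        by (subst eq) (auto simp: type_of_def)
    qed
    also have "\<dots> \<longleftrightarrow> type_of ?G M w = type_of ?G M' w'"
      unfolding type_of_eq_iff by (simp add: ball_Un Dia[OF M(1)] Dia[OF M(2)] del: sat.simps(10))
    finally show ?thesis .
  qed
  moreover have "?G \<subseteq> C" "finite ?G"
    using Var_flat Dia_flat c(1) F(2) assms by auto
  ultimately show ?case
    by (intro exI[of _ ?G]) blast
qed

lemma team_bisim_iff_types:
  assumes "finite X"
  obtains F where "F \<subseteq> C" "finite F"
    "\<And>M t M' t'. \<lbrakk>M \<in> K; t \<subseteq> worlds M; M' \<in> K; t' \<subseteq> worlds M'\<rbrakk> \<Longrightarrow>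
      team_bisim X k M t M' t' \<longleftrightarrow> type_of F M ` t = type_of F M' ` t'"
proof -
  obtain F where F: "F \<subseteq> C" "finite F"
    and F_bisim: "\<forall>M\<in>K. \<forall>w\<in>worlds M. \<forall>M'\<in>K. \<forall>w'\<in>worlds M'.
      bisim X k M w M' w' \<longleftrightarrow> type_of F M w = type_of F M' w'"
    using bisim_iff_types[OF assms, of k] by (elim exE conjE) (rule that)
  have "team_bisim X k M t M' t' \<longleftrightarrow> type_of F M ` t = type_of F M' ` t'"
    if M: "M \<in> K" "t \<subseteq> worlds M" "M' \<in> K" "t' \<subseteq> worlds M'" for M t M' t'
  proof -
    have "team_bisim X k M t M' t' \<longleftrightarrow> (\<forall>w\<in>t. \<exists>w'\<in>t'. type_of F M w = type_of F M' w') \<and>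
        (\<forall>w'\<in>t'. \<exists>w\<in>t. type_of F M w = type_of F M' w')"
      unfolding team_bisim_def using M(2,4)
      by (simp add: F_bisim M(1,3) subset_iff cong: ball_cong bex_cong)
    also have "\<dots> \<longleftrightarrow> type_of F M ` t = type_of F M' ` t'"
      by (simp only: image_eq_image_iff)
    finally show ?thesis .
  qed
  with F show ?thesis
    by (rule that)
qed

text \<open>A team has at most \<open>Suc m\<close> types iff it splits into a part with at most
  \<open>m\<close> types and a part of constant type.\<close>

lemma bound_number_of_types:
  assumes F: "finite F"
    and Dep_closed: "\<And>a. a \<in> F \<Longrightarrow> Dep [] a \<in> L"
    and Disj_closed: "\<And>f g. f \<in> L \<Longrightarrow> g \<in> L \<Longrightarrow> Disj f g \<in> L"
  shows "\<exists>f\<in>L. \<forall>M\<in>K. \<forall>t\<subseteq>worlds M. sat M t f \<longleftrightarrow> card (type_of F M ` t) \<le> m"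
proof (induction m)
  case 0
  have "Bot \<in> L"
    using Bot_flat flat_subset by blast
  then show ?case
    \<comment> \<open>Finiteness matters here: an infinite set would also have \<open>card\<close>
      zero.\<close>
    using finite_types[OF F] by (intro bexI[of _ Bot]) (auto simp: card_eq_0_iff)
next
  case (Suc m)
  then obtain f where f: "f \<in> L"
    "\<And>M t. M \<in> K \<Longrightarrow> t \<subseteq> worlds M \<Longrightarrow> sat M t f \<longleftrightarrow> card (type_of F M ` t) \<le> m"
    by blast
  \<comment> \<open>The constancy atoms for all members of \<open>F\<close> together say that at
    most one type occurs.\<close>
  have "\<exists>g\<in>L. \<forall>M\<in>K. \<forall>t\<subseteq>worlds M. sat M t g \<longleftrightarrow>
      (\<forall>a\<in>F. \<forall>v\<in>t. \<forall>w\<in>t. sat M {v} a \<longleftrightarrow> sat M {w} a)"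
  proof (rule conj_closed[OF F], rule)
    fix a assume "a \<in> F"
    with Dep_closed have "Dep [] a \<in> L"
      by blast
    then show "\<exists>g\<in>L. \<forall>M\<in>K. \<forall>t\<subseteq>worlds M. sat M t g \<longleftrightarrow> (\<forall>v\<in>t. \<forall>w\<in>t. sat M {v} a \<longleftrightarrow> sat M {w} a)"
      by (intro bexI[of _ "Dep [] a"]) auto
  qed
  then obtain g where g_mem: "g \<in> L" and g: "\<forall>M\<in>K. \<forall>t\<subseteq>worlds M.
      sat M t g \<longleftrightarrow> (\<forall>a\<in>F. \<forall>v\<in>t. \<forall>w\<in>t. sat M {v} a \<longleftrightarrow> sat M {w} a)"
    by (elim bexE) (rule that)
  have sat_g: "sat M t g \<longleftrightarrow> (\<forall>v\<in>t. \<forall>w\<in>t. type_of F M v = type_of F M w)"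
    if "M \<in> K" "t \<subseteq> worlds M" for M t
    using g that unfolding type_of_eq_iff by simp blast
  have "sat M t (Disj f g) \<longleftrightarrow> card (type_of F M ` t) \<le> Suc m" if M: "M \<in> K" "t \<subseteq> worlds M" for M t
  proof
    assume "sat M t (Disj f g)"
    then obtain s u where su: "s \<subseteq> worlds M" "u \<subseteq> worlds M" "t \<subseteq> s \<union> u" "sat M s f" "sat M u g"
      by auto
    have "card (type_of F M ` s) \<le> m"
      using f(2) M su by blast
    moreover have "card (type_of F M ` u) \<le> 1"
    proof -
      have "\<forall>v\<in>u. \<forall>w\<in>u. type_of F M v = type_of F M w"
        using sat_g[OF M(1) su(2)] su(5) by blast
      then show ?thesis
        using finite_types[OF F, of M u] unfolding One_nat_def by (subst card_le_Suc0_iff_eq) blast+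
    qed
    moreover have "card (type_of F M ` t) \<le> card (type_of F M ` s \<union> type_of F M ` u)"
      using su(3) finite_types[OF F] by (intro card_mono) auto
    moreover have "\<dots> \<le> card (type_of F M ` s) + card (type_of F M ` u)"
      by (rule card_Un_le)
    ultimately show "card (type_of F M ` t) \<le> Suc m"
      by linarith
  next
    assume *: "card (type_of F M ` t) \<le> Suc m"
    show "sat M t (Disj f g)"
    proof (cases "t = {}")
      case True
      then show ?thesis
        using f(2)[OF M(1), of "{}"] sat_g[OF M(1), of "{}"] by auto
    next
      case False
      then obtain w where w: "w \<in> t"
        by blast
      \<comment> \<open>Removing all worlds that share the type of \<open>w\<close> lowers the
        number of types by one, and the removed part has constant type.\<close>
      define u where "u = {v \<in> t. type_of F M v = type_of F M w}"
      have "type_of F M ` (t - u) = type_of F M ` t - {type_of F M w}"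
        by (auto simp: u_def)
      then have "card (type_of F M ` (t - u)) \<le> m"
        using * w finite_types[OF F, of M t] by (simp add: card_Diff_singleton)
      then have "sat M (t - u) f"
        using f(2)[OF M(1), of "t - u"] M(2) by blast
      moreover have "u \<subseteq> worlds M"
        using M(2) by (auto simp: u_def)
      moreover from this have "sat M u g"
        using sat_g[OF M(1)] by (simp add: u_def)
      ultimately show ?thesis
        using M(2) unfolding sat.simps by (intro exI[of _ "t - u"] exI[of _ u]) auto
    qed
  qed
  moreover have "Disj f g \<in> L"
    using f(1) g_mem by (rule Disj_closed)
  ultimately show ?case
    by blast
qed

text \<open>The argument common to the logics. The assumption \<open>omit\<close> is the place where
  implication or dependence atoms enter.\<close>

lemma define_convex_invariant:
  assumes X: "finite X"
    and omit: "\<And>F T. \<lbrakk>finite F; F \<subseteq> C; finite T; T \<noteq> {}\<rbrakk> \<Longrightarrow>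
      \<exists>f\<in>L. \<forall>M\<in>K. \<forall>t\<subseteq>worlds M. sat M t f \<longleftrightarrow> \<not> T \<subseteq> type_of F M ` t"
    and P: "P \<in> convex_invariant_properties K X"
  shows "P \<in> property_of K ` L"
proof (cases "P = {}")
  \<comment> \<open>The empty property is treated apart: for it the empty set of types would lie in
    \<open>?down\<close>, a case not covered by \<open>omit\<close>. A contradiction defines it, as
    \<open>Bot\<close> forces the team to be empty and \<open>Might\<close> forbids that.\<close>
  case True
  obtain a where a: "a \<in> C"
    using Bot_flat by blast
  have "And Bot (Might a) \<in> L"
    using Bot_flat a flat_subset And_closed Might_closed by blast
  moreover have "property_of K (And Bot (Might a)) = {}"
    by (auto simp: property_of_def)
  ultimately show ?thesis
    using True by blast
next
  case False
  have P_sub: "P \<subseteq> team_models K" and conv: "convex P"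
    using P by (auto simp: convex_invariant_properties_def)
  from P obtain k where inv: "\<forall>(M, t)\<in>team_models K. \<forall>(M', t')\<in>team_models K.
      (M, t) \<in> P \<longrightarrow> team_bisim X k M t M' t' \<longrightarrow> (M', t') \<in> P"
    unfolding convex_invariant_properties_def bounded_bisim_invariant_def by blast
  obtain F where F: "F \<subseteq> C" "finite F"
    "\<And>M t M' t'. \<lbrakk>M \<in> K; t \<subseteq> worlds M; M' \<in> K; t' \<subseteq> worlds M'\<rbrakk> \<Longrightarrow>
      team_bisim X k M t M' t' \<longleftrightarrow> type_of F M ` t = type_of F M' ` t'"
    by (rule team_bisim_iff_types[OF X, of k]) (rule that)
  define types where "types = (\<lambda>(M :: ('w, 'p) kripke, t). type_of F M ` t)"
  have types_sub: "types x \<subseteq> Pow F" for x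
    by (auto simp: types_def type_of_def split: prod.splits)
  \<comment> \<open>Membership in \<open>P\<close> depends only on the set of types realised by the
    team.\<close>
  have types_inv: "y \<in> P" if "x \<in> P" "y \<in> team_models K" "types x = types y" for x y
  proof -
    obtain M t M' t' where xy: "x = (M, t)" "y = (M', t')"
      by (metis surj_pair)
    have tm: "(M, t) \<in> team_models K" "(M', t') \<in> team_models K"
      using that P_sub by (auto simp: xy)
    moreover have "team_bisim X k M t M' t'"
      using F(3)[of M t M' t'] tm that(3) by (auto simp: team_models_def types_def xy)
    ultimately show ?thesis
      using inv that(1) unfolding xy by blast
  qed
  \<comment> \<open>Convexity only compares teams of one model. The upper bound \<open>z\<close> lives in a model realising
    all types concerned, so the comparison can be moved there.\<close>
  have types_convex: "y \<in> P"
    if x: "x \<in> P" and y: "y \<in> team_models K" and z: "z \<in> P" and sub: "types x \<subseteq> types y" "types y \<subseteq> types z"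
    for x y z
  proof -
    obtain M t where z_eq: "z = (M, t)"
      by fastforce
    define r where "r A = {w \<in> t. type_of F M w \<in> A}" for A
    have r: "types (M, r A) = A" if "A \<subseteq> types z" for A
      using that by (auto simp: types_def r_def z_eq)
    have r_sub: "(M, r A) \<in> team_models K" for A
      using z P_sub by (auto simp: z_eq r_def team_models_def)
    have "(M, r (types x)) \<in> P"
      using types_inv[OF x r_sub] r sub by (metis subset_trans)
    moreover have "r (types x) \<subseteq> r (types y)" "r (types y) \<subseteq> t"
      using sub(1) by (auto simp: r_def)
    ultimately have "(M, r (types y)) \<in> P"
      using conv z unfolding z_eq convex_def by blast
    then show ?thesis
      using types_inv y r[OF sub(2)] by blast
  qed
  let ?up = "{B \<in> Pow (Pow F). \<not> (\<exists>x\<in>P. types x \<subseteq> B)}"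
  let ?down = "{A \<in> Pow (Pow F). \<not> (\<exists>x\<in>P. A \<subseteq> types x)}"
  have fin: "finite ?up" "finite ?down"
    using F(2) by auto
  have "\<exists>f\<in>L. \<forall>M\<in>K. \<forall>t\<subseteq>worlds M. sat M t f \<longleftrightarrow> (\<forall>B\<in>?up. type_of F M ` t \<inter> - B \<noteq> {})"
    using realise_some_type[OF F(2,1)] by (intro conj_closed[OF fin(1)]) blast
  then obtain f where f: "f \<in> L"
    "\<forall>M\<in>K. \<forall>t\<subseteq>worlds M. sat M t f \<longleftrightarrow> (\<forall>B\<in>?up. type_of F M ` t \<inter> - B \<noteq> {})"
    by (elim bexE) (rule that)
  \<comment> \<open>Since \<open>P\<close> has a member, the empty set lies below its types and
    hence is not in \<open>?down\<close>.\<close>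
  have down_fin: "finite A" "A \<noteq> {}" if "A \<in> ?down" for A
    using that False F(2) by (auto intro: finite_subset[of _ "Pow F"])
  have "\<exists>f\<in>L. \<forall>M\<in>K. \<forall>t\<subseteq>worlds M. sat M t f \<longleftrightarrow> (\<forall>A\<in>?down. \<not> A \<subseteq> type_of F M ` t)"
    using omit[OF F(2,1) down_fin] by (intro conj_closed[OF fin(2)] ballI)
  then obtain g where g: "g \<in> L"
    "\<forall>M\<in>K. \<forall>t\<subseteq>worlds M. sat M t g \<longleftrightarrow> (\<forall>A\<in>?down. \<not> A \<subseteq> type_of F M ` t)"
    by (elim bexE) (rule that)
  have "(M, t) \<in> P \<longleftrightarrow> sat M t (And f g)" if M: "M \<in> K" "t \<subseteq> worlds M" for M t
  proof -
    have T: "type_of F M ` t = types (M, t)"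
      by (simp add: types_def)
    have tm: "(M, t) \<in> team_models K"
      using M by (simp add: team_models_def)
    have "sat M t f \<longleftrightarrow> (\<forall>B\<in>?up. \<not> types (M, t) \<subseteq> B)"
      using f(2) M by (simp add: T disjoint_eq_subset_Compl)
    \<comment> \<open>If no member of \<open>P\<close> lies below the team, its own set of types is
      a \<open>B\<close> in \<open>?up\<close> and violates the condition. The same choice works for
      \<open>?down\<close> below.\<close>
    also have "\<dots> \<longleftrightarrow> (\<exists>x\<in>P. types x \<subseteq> types (M, t))"
      using types_sub[of "(M, t)"] by blast
    finally have sat_f: "sat M t f \<longleftrightarrow> (\<exists>x\<in>P. types x \<subseteq> types (M, t))" .
    have "sat M t g \<longleftrightarrow> (\<forall>A\<in>?down. \<not> A \<subseteq> types (M, t))"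
      using g(2) M by (simp add: T)
    also have "\<dots> \<longleftrightarrow> (\<exists>x\<in>P. types (M, t) \<subseteq> types x)"
      using types_sub[of "(M, t)"] by blast
    finally have sat_g: "sat M t g \<longleftrightarrow> (\<exists>x\<in>P. types (M, t) \<subseteq> types x)" .
    show ?thesis
      unfolding sat.simps sat_f sat_g using types_convex[OF _ tm] by blast
  qed
  then have "property_of K (And f g) = P"
    using P_sub by (auto simp: property_of_def team_models_def)
  then show ?thesis
    using And_closed[OF f(1) g(1)] by blast
qed

end


section \<open>The three logics\<close>

text \<open>\<open>Imp a Bot\<close> holds exactly when \<open>Might a\<close> fails, and for flat
  \<open>a\<close> the latter is a condition on single worlds.\<close>

lemma flat_on_Imp_Bot:
  assumes "flat_on K a"
  shows "flat_on K (Imp a Bot)"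
    and "\<forall>M\<in>K. \<forall>w\<in>worlds M. sat M {w} (Imp a Bot) \<longleftrightarrow> \<not> sat M {w} a"
proof -
  have *: "sat M t (Imp a Bot) \<longleftrightarrow> (\<forall>w\<in>t. \<not> sat M {w} a)" if M: "M \<in> K" "t \<subseteq> worlds M" for M t
  proof -
    have "sat M t (Imp a Bot) \<longleftrightarrow> \<not> sat M t (Might a)"
      by auto
    then show ?thesis
      using sat_Might_flat[OF assms M] by blast
  qed
  then show "flat_on K (Imp a Bot)"
    by (rule flat_onI)
  show "\<forall>M\<in>K. \<forall>w\<in>worlds M. sat M {w} (Imp a Bot) \<longleftrightarrow> \<not> sat M {w} a"
  proof (intro ballI)
    fix M w assume "M \<in> K" "w \<in> worlds M"
    then show "sat M {w} (Imp a Bot) \<longleftrightarrow> \<not> sat M {w} a"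
      using *[of M "{w}"] by simp
  qed
qed

text \<open>The flat part is cut out semantically, as all formulas of the logic that are flat on
  \<open>K\<close>.\<close>

lemma imp_ML_flat_fragment:
  assumes "K \<subseteq> kripke_models"
  shows "flat_fragment K X {f \<in> imp_ML X. flat_on K f} (imp_ML X)"
proof
  fix a
  assume a: "a \<in> {f \<in> imp_ML X. flat_on K f}"
  then have "Imp a Bot \<in> {f \<in> imp_ML X. flat_on K f}"
    using flat_on_Imp_Bot(1) by (auto intro: imp_ML.intros)
  with a show "\<exists>b\<in>{f \<in> imp_ML X. flat_on K f}. \<forall>M\<in>K. \<forall>w\<in>worlds M. sat M {w} b \<longleftrightarrow> \<not> sat M {w} a"
    using flat_on_Imp_Bot(2) by blast
next
  fix a b
  assume "a \<in> {f \<in> imp_ML X. flat_on K f}" "b \<in> {f \<in> imp_ML X. flat_on K f}"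
  then show "And a b \<in> {f \<in> imp_ML X. flat_on K f}"
    by (auto intro: imp_ML.intros simp: flat_on_def)
qed (use assms in \<open>auto intro: imp_ML.intros flat_on_Dia simp: flat_on_def[of _ "Var _"] flat_on_def[of _ Bot]\<close>)

lemma imp_ML_complete:
  fixes X :: "'p set" and K :: "('w, 'p) kripke set"
  assumes "finite X" "K \<subseteq> kripke_models"
  shows "convex_invariant_properties K X \<subseteq> property_of K ` imp_ML X"
proof
  fix P assume P: "P \<in> convex_invariant_properties K X"
  interpret flat_fragment K X "{f \<in> imp_ML X. flat_on K f}" "imp_ML X"
    by (rule imp_ML_flat_fragment[OF assms(2)])
  show "P \<in> property_of K ` imp_ML X"
  proof (rule define_convex_invariant[OF assms(1) _ P])
    fix F and T :: "'p fm set set"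
    assume F: "finite F" "F \<subseteq> {f \<in> imp_ML X. flat_on K f}" and T: "finite T" "T \<noteq> {}"
    have "\<exists>f\<in>imp_ML X. \<forall>M\<in>K. \<forall>t\<subseteq>worlds M. sat M t f \<longleftrightarrow> (\<forall>S\<in>T. type_of F M ` t \<inter> {S} \<noteq> {})"
      using realise_some_type[OF F] by (intro conj_closed[OF T(1)]) blast
    then obtain f where f: "f \<in> imp_ML X"
      "\<forall>M\<in>K. \<forall>t\<subseteq>worlds M. sat M t f \<longleftrightarrow> (\<forall>S\<in>T. type_of F M ` t \<inter> {S} \<noteq> {})"
      by (elim bexE) (rule that)
    have sat_f: "sat M t f \<longleftrightarrow> T \<subseteq> type_of F M ` t" if "M \<in> K" "t \<subseteq> worlds M" for M t
      using f(2) that by (simp add: subset_eq)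
    have "sat M t (Imp f Bot) \<longleftrightarrow> \<not> T \<subseteq> type_of F M ` t" if M: "M \<in> K" "t \<subseteq> worlds M" for M t
    proof -
      have "sat M t (Imp f Bot) \<longleftrightarrow> (\<forall>s\<subseteq>t. T \<subseteq> type_of F M ` s \<longrightarrow> s = {})"
        using sat_f[OF M(1)] M(2) by (auto dest: subset_trans)
      \<comment> \<open>If some subteam realises all of \<open>T\<close>, then so does
        \<open>t\<close>, which can itself be taken as the subteam. Nonemptiness of \<open>T\<close>
        excludes the empty team.\<close>
      also have "\<dots> \<longleftrightarrow> \<not> T \<subseteq> type_of F M ` t"
        using T(2) by (metis image_empty image_mono order_refl subset_empty subset_trans)
      finally show ?thesis .
    qed
    moreover have "Imp f Bot \<in> imp_ML X"
      using f(1) by (intro imp_ML.intros)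
    ultimately show "\<exists>f\<in>imp_ML X. \<forall>M\<in>K. \<forall>t\<subseteq>worlds M. sat M t f \<longleftrightarrow> \<not> T \<subseteq> type_of F M ` t"
      by blast
  qed
qed

text \<open>Carries definability of all convex invariant properties over to
  \<open>inq_ML\<close>.\<close>

lemma imp_ML_subset_inq_ML: "imp_ML X \<subseteq> inq_ML X"
proof
  fix f assume "f \<in> imp_ML X"
  then show "f \<in> inq_ML X"
    by induction (auto intro: inq_ML.intros)
qed

section \<open>The logic with dependence atoms\<close>

lemma classical_ML_subset_dep_ML: "classical_ML X \<subseteq> dep_ML X"
proof
  fix f assume "f \<in> classical_ML X"
  then show "f \<in> dep_ML X"
    by induction (auto intro: dep_ML.intros)
qed

text \<open>Flat formulas are downward closed, so the part satisfying \<open>a\<close> may be shrunk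
  to \<open>t - u\<close>.\<close>

lemma sat_Disj_flat:
  assumes "flat_on K a" "M \<in> K" "t \<subseteq> worlds M"
  shows "sat M t (Disj a g) \<longleftrightarrow>
    (\<exists>u\<subseteq>worlds M. (\<forall>w\<in>t - u. sat M {w} a) \<and> sat M u g)"
proof
  assume "sat M t (Disj a g)"
  then obtain s u where "s \<subseteq> worlds M" "u \<subseteq> worlds M" "t \<subseteq> s \<union> u" "sat M s a" "sat M u g"
    by auto
  with flat_onD[OF assms(1,2), of s] show "\<exists>u\<subseteq>worlds M. (\<forall>w\<in>t - u. sat M {w} a) \<and> sat M u g"
    by blast
next
  assume "\<exists>u\<subseteq>worlds M. (\<forall>w\<in>t - u. sat M {w} a) \<and> sat M u g"
  then obtain u where u: "u \<subseteq> worlds M" "\<forall>w\<in>t - u. sat M {w} a" "sat M u g"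
    by blast
  have "sat M (t - u) a"
    using flat_onD[OF assms(1,2), of "t - u"] u(2) assms(3) by blast
  with u assms(3) show "sat M t (Disj a g)"
    unfolding sat.simps by (intro exI[of _ "t - u"] exI[of _ u]) auto
qed

lemma flat_on_Disj:
  assumes "flat_on K a" "flat_on K b"
  shows "flat_on K (Disj a b)"
proof -
  have "sat M t (Disj a b) \<longleftrightarrow> (\<forall>w\<in>t. sat M {w} a \<or> sat M {w} b)"
    if M: "M \<in> K" "t \<subseteq> worlds M" for M t
  proof
    assume "sat M t (Disj a b)"
    then show "\<forall>w\<in>t. sat M {w} a \<or> sat M {w} b"
      unfolding sat_Disj_flat[OF assms(1) M] using flat_onD[OF assms(2) M(1)] by blast
  next
    assume *: "\<forall>w\<in>t. sat M {w} a \<or> sat M {w} b"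
    let ?u = "{w \<in> t. sat M {w} b}"
    have "?u \<subseteq> worlds M"
      using M(2) by blast
    moreover from this have "sat M ?u b"
      using flat_onD[OF assms(2) M(1), of ?u] by blast
    ultimately show "sat M t (Disj a b)"
      unfolding sat_Disj_flat[OF assms(1) M] using * by blast
  qed
  then show ?thesis
    by (rule flat_onI)
qed

lemma classical_ML_flat: "a \<in> classical_ML X \<Longrightarrow> flat_on K a"
proof (induction rule: classical_ML.induct)
  case (4 a b)
  then show ?case
    by (auto simp: flat_on_def)
next
  case (5 a b)
  then show ?case
    by (intro flat_on_Disj)
qed (auto simp: flat_on_def)

lemma classical_ML_flat_fragment:
  assumes "K \<subseteq> kripke_models"
  shows "flat_fragment K X (classical_ML X) (dep_ML X)"
proof
  fix a assume "a \<in> classical_ML X"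
  then show "\<exists>b\<in>classical_ML X. \<forall>M\<in>K. \<forall>w\<in>worlds M. sat M {w} b \<longleftrightarrow> \<not> sat M {w} a"
    by (intro bexI[of _ "Neg a"]) (auto intro: classical_ML.intros)
qed (use assms classical_ML_subset_dep_ML in
    \<open>auto intro: classical_ML.intros dep_ML.intros classical_ML_flat\<close>)

lemma dep_ML_complete:
  fixes X :: "'p set" and K :: "('w, 'p) kripke set"
  assumes "finite X" "K \<subseteq> kripke_models"
  shows "convex_invariant_properties K X \<subseteq> property_of K ` dep_ML X"
proof
  fix P assume P: "P \<in> convex_invariant_properties K X"
  interpret flat_fragment K X "classical_ML X" "dep_ML X"
    by (rule classical_ML_flat_fragment[OF assms(2)])
  show "P \<in> property_of K ` dep_ML X"
  proof (rule define_convex_invariant[OF assms(1) _ P])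
    fix F and T :: "'p fm set set"
    assume F: "finite F" "F \<subseteq> classical_ML X" and T: "finite T" "T \<noteq> {}"
    obtain c where c: "c \<in> classical_ML X"
      "\<forall>M\<in>K. \<forall>w\<in>worlds M. sat M {w} c \<longleftrightarrow> type_of F M w \<in> - T"
      using define_types[OF F] by blast
    have Dep: "Dep [] a \<in> dep_ML X" if "a \<in> F" for a
      using F(2) that by (intro dep_ML.intros) auto
    obtain g where g: "g \<in> dep_ML X"
      "\<And>M t. M \<in> K \<Longrightarrow> t \<subseteq> worlds M \<Longrightarrow> sat M t g \<longleftrightarrow> card (type_of F M ` t) \<le> card T - 1"
      using bound_number_of_types[OF F(1) Dep dep_ML.intros(6), of "card T - 1"] by blast
    \<comment> \<open>As \<open>T\<close> is finite and nonempty, the subtraction does not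
      truncate.\<close>
    have lt: "n \<le> card T - 1 \<longleftrightarrow> n < card T" for n
      using T by (cases "card T") auto
    have "sat M t (Disj c g) \<longleftrightarrow> \<not> T \<subseteq> type_of F M ` t" if M: "M \<in> K" "t \<subseteq> worlds M" for M t
    proof -
      have c_iff: "(\<forall>w\<in>t - u. sat M {w} c) \<longleftrightarrow> type_of F M ` (t - u) \<inter> T = {}" for u
        using c(2) M by (auto simp: subset_iff)
      have "sat M t (Disj c g) \<longleftrightarrow>
          (\<exists>u\<subseteq>worlds M. type_of F M ` (t - u) \<inter> T = {} \<and> card (type_of F M ` u) < card T)"
        unfolding sat_Disj_flat[OF flat[OF c(1)] M] c_iff lt[symmetric]
        by (intro ex_cong1) (simp add: g(2)[OF M(1)] cong: conj_cong)
      also have "\<dots> \<longleftrightarrow> \<not> T \<subseteq> type_of F M ` t"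
      proof
        assume "\<exists>u\<subseteq>worlds M. type_of F M ` (t - u) \<inter> T = {} \<and> card (type_of F M ` u) < card T"
        then obtain u where u: "type_of F M ` (t - u) \<inter> T = {}" "card (type_of F M ` u) < card T"
          by blast
        \<comment> \<open>With fewer than \<open>card T\<close> types, \<open>u\<close> misses a
          member of \<open>T\<close>; the rest of \<open>t\<close> realises none of them.\<close>
        have "\<not> T \<subseteq> type_of F M ` u"
          using u(2) card_mono[OF finite_types[OF F(1), of M u], of T] by auto
        then show "\<not> T \<subseteq> type_of F M ` t"
          using u(1) by blast
      next
        assume *: "\<not> T \<subseteq> type_of F M ` t"
        \<comment> \<open>The worlds with types in \<open>T\<close>: they realise a proper subset of
          \<open>T\<close>, hence fewer than \<open>card T\<close> types.\<close>
        define u where "u = {w \<in> t. type_of F M w \<in> T}"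
        have "type_of F M ` u \<subset> T"
          using * by (auto simp: u_def)
        then have "card (type_of F M ` u) < card T"
          by (rule psubset_card_mono[OF T(1)])
        then show "\<exists>u\<subseteq>worlds M. type_of F M ` (t - u) \<inter> T = {} \<and> card (type_of F M ` u) < card T"
          using M(2) by (intro exI[of _ u]) (auto simp: u_def)
      qed
      finally show ?thesis .
    qed
    moreover have "Disj c g \<in> dep_ML X"
      using c(1) g(1) classical_ML_subset_dep_ML by (intro dep_ML.intros) auto
    ultimately show "\<exists>f\<in>dep_ML X. \<forall>M\<in>K. \<forall>t\<subseteq>worlds M. sat M t f \<longleftrightarrow> \<not> T \<subseteq> type_of F M ` t"
      by blast
  qed
qed

text \<open>The two logics with a dotted disjunction are treated separately because they can detect
  worlds outside the team. Over all Kripke models they define every convex invariant property and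
  only convex ones; equality of the two classes is obtained where \<open>same_types\<close> restores
  invariance.\<close>

theorem theorem2p21:
  fixes X :: "'p set"
  assumes "finite X"
  shows "expressively_complete (kripke_models :: ('w, 'p) kripke set) X (imp_ML X)
    \<and> (\<forall>L\<in>{dep_ML X, inq_ML X}.
          convex_invariant_properties (kripke_models :: ('w, 'p) kripke set) X
            \<subseteq> property_of kripke_models ` L
        \<and> (\<forall>f\<in>L. convex (property_of (kripke_models :: ('w, 'p) kripke set) f))
        \<and> (\<forall>K\<subseteq>(kripke_models :: ('w, 'p) kripke set).
              same_types X K \<longrightarrow> expressively_complete K X L))"
proof (intro conjI ballI allI impI)
  let ?K = "kripke_models :: ('w, 'p) kripke set"
  have definable: "property_of K ` L \<subseteq> convex_invariant_properties K X"
    if "\<And>f. f \<in> L \<Longrightarrow> \<exists>k. invariant_upto K X k f" for L and K :: "('w, 'p) kripke set"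
    by (rule image_subsetI) (rule property_of_convex_invariant[OF that])
  have complete: "convex_invariant_properties K X \<subseteq> property_of K ` L"
    if L: "L \<in> {dep_ML X, inq_ML X}" and K: "K \<subseteq> kripke_models" for L and K :: "('w, 'p) kripke set"
  proof -
    \<comment> \<open>The inquisitive logic inherits definability from the implicational one; the
      dependence logic has its own construction.\<close>
    have "L = dep_ML X \<or> imp_ML X \<subseteq> L"
      using L imp_ML_subset_inq_ML by auto
    then show ?thesis
    proof
      assume "imp_ML X \<subseteq> L"
      then have "property_of K ` imp_ML X \<subseteq> property_of K ` L"
        by (rule image_mono)
      with imp_ML_complete[OF assms K] show ?thesis
        by (rule subset_trans)
    qed (simp add: dep_ML_complete[OF assms K])
  qed
  show "expressively_complete ?K X (imp_ML X)"
    unfolding expressively_complete_def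
    using definable[OF imp_ML_invariant[OF order_refl]] imp_ML_complete[OF assms order_refl]
    by (rule subset_antisym)
  fix L assume L: "L \<in> {dep_ML X, inq_ML X}"
  show "convex_invariant_properties ?K X \<subseteq> property_of ?K ` L"
    using L order_refl by (rule complete)
  show "convex (property_of ?K f)" for f
    by (rule convex_property_of)
  fix K assume K: "K \<subseteq> ?K" "same_types X K"
  have "\<exists>k. invariant_upto K X k f" if "f \<in> L" for f
    using L that dep_ML_invariant[OF K] inq_ML_invariant[OF K] by auto
  then show "expressively_complete K X L"
    unfolding expressively_complete_def by (intro subset_antisym definable complete[OF L K(1)])
qed

end
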